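(* Let $h\ge 2$ be an even integer and $r\ge 1$ an integer. Let $Y$ be the graph obtained from $X_{h,r}$ by the $h$-direction construction (described in the context). Then $Y\cong X_{2h,r}$.
   Context: All graphs are finite, simple and undirected. For an even integer $h\ge 2$ and an integer $r\ge 1$, the graph $X_{h,r}$ is the join $$X_{h,r}=\overline{K}_{h-1}\vee\left(\bigvee_{i=1}^{r}\left(\tfrac h2\right)K_2\right),$$ where $\overline{K}_{h-1}$ is the edgeless graph on $h-1$ vertices, $\left(\frac h2\right)K_2$ is the disjoint union of $\frac h2$ copies of $K_2$, and the join $\vee$ of pairwise vertex-disjoint graphs is obtained from their disjoint union by adding all edges between vertices of different constituents. Thus $V(X_{h,r})=V_0^{(h)}\,\dot\cup\,V_1^{(h)}\,\dot\cup\cdots\dot\cup\,V_r^{(h)}$, where $V_0^{(h)}$ induces $\overline K_{h-1}$ and each $V_i^{(h)}$, $1\le i\le r$, induces $\left(\frac h2\right)K_2$. The $h$-direction construction. Start with $X_{h,r}$ (keeping all of its vertices and edges). 1. Vertex addition: take pairwise disjoint sets $B_0,B_1,\dots,B_r$ of $h$ new vertices each, and put $V_i'=V_i^{(h)}\cup B_i$ for $0\le i\le r$. 2. Edge addition: (a) for each $i=1,\dots,r$, pair the $h$ vertices of $B_i$ by $\frac h2$ disjoint edges, so that $B_i$ induces $\left(\frac h2\right)K_2$; (b) for all $0\le i<j\le r$, join every vertex of $V_i'$ to every vertex of $V_j'$. No other edges are added. The resulting graph, on the vertex set $V_0'\cup V_1'\cup\dots\cup V_r'$, is $Y$. *)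

theory Defs
  imports "HOL-Library.Disjoint_Sets"
begin

record 'a graph =
  verts :: "'a set"
  edges :: "'a set set"

definition simple_graph :: "'a graph \<Rightarrow> bool" where
  "simple_graph G \<longleftrightarrow>
     finite (verts G) \<and> (\<forall>e\<in>edges G. e \<subseteq> verts G \<and> card e = 2)"

definition graph_iso :: "('a \<Rightarrow> 'b) \<Rightarrow> 'a graph \<Rightarrow> 'b graph \<Rightarrow> bool" where
  "graph_iso f G H \<longleftrightarrow>
     bij_betw f (verts G) (verts H) \<and> edges H = (\<lambda>e. f ` e) ` edges G"

definition isomorphic :: "'a graph \<Rightarrow> 'b graph \<Rightarrow> bool" (infix "\<cong>\<^sub>g" 50) where
  "G \<cong>\<^sub>g H \<longleftrightarrow> (\<exists>f. graph_iso f G H)"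

definition edgeless_graph :: "nat \<Rightarrow> nat graph" where
  "edgeless_graph n = \<lparr>verts = {..<n}, edges = {}\<rparr>"

definition complete_graph :: "nat \<Rightarrow> nat graph" where
  "complete_graph n = \<lparr>verts = {..<n}, edges = {e. e \<subseteq> {..<n} \<and> card e = 2}\<rparr>"

text \<open>Constituents are made vertex-disjoint by tagging each vertex with its index,
  respectively with \<^const>\<open>Inl\<close> or \<^const>\<open>Inr\<close>.\<close>

definition disjoint_union :: "'i set \<Rightarrow> ('i \<Rightarrow> 'a graph) \<Rightarrow> ('i \<times> 'a) graph" where
  "disjoint_union I G =
     \<lparr>verts = (SIGMA i:I. verts (G i)),
      edges = (\<Union>i\<in>I. (\<lambda>e. Pair i ` e) ` edges (G i))\<rparr>"

definition copies :: "nat \<Rightarrow> 'a graph \<Rightarrow> (nat \<times> 'a) graph" where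
  "copies k G = disjoint_union {..<k} (\<lambda>_. G)"

definition join_family :: "'i set \<Rightarrow> ('i \<Rightarrow> 'a graph) \<Rightarrow> ('i \<times> 'a) graph" where
  "join_family I G =
     \<lparr>verts = verts (disjoint_union I G),
      edges = edges (disjoint_union I G) \<union>
        {{(i, u), (j, v)} | i j u v.
           i \<in> I \<and> j \<in> I \<and> i \<noteq> j \<and> u \<in> verts (G i) \<and> v \<in> verts (G j)}\<rparr>"

definition join :: "'a graph \<Rightarrow> 'b graph \<Rightarrow> ('a + 'b) graph" where
  "join G H =
     \<lparr>verts = verts G <+> verts H,
      edges = (\<lambda>e. Inl ` e) ` edges G \<union> (\<lambda>e. Inr ` e) ` edges H \<union>
        {{Inl u, Inr v} | u v. u \<in> verts G \<and> v \<in> verts H}\<rparr>"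

definition X_graph :: "nat \<Rightarrow> nat \<Rightarrow> (nat + nat \<times> nat \<times> nat) graph" where
  "X_graph h r =
     join (edgeless_graph (h - 1))
          (join_family {1..r} (\<lambda>_. copies (h div 2) (complete_graph 2)))"

lemma finite_verts_X_graph: "finite (verts (X_graph h r))"
  by (auto simp: X_graph_def join_def join_family_def copies_def disjoint_union_def
      edgeless_graph_def complete_graph_def)

lemma simple_graph_X_graph: "simple_graph (X_graph h r)"
  unfolding simple_graph_def
proof (intro conjI ballI finite_verts_X_graph)
  fix e assume "e \<in> edges (X_graph h r)"
  then show "e \<subseteq> verts (X_graph h r)"
    unfolding X_graph_def join_def join_family_def copies_def disjoint_union_def
      edgeless_graph_def complete_graph_def
    by fastforce
  have c: "card (Pair i ` e) = card e" "card ((Inr :: _ \<Rightarrow> 'x + _) ` e) = card e"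
    for i :: nat and e :: "'b set"
    by (auto intro!: card_image inj_onI)
  show "card e = 2"
    using \<open>e \<in> edges (X_graph h r)\<close>
    by (auto simp: X_graph_def join_def join_family_def copies_def disjoint_union_def
        edgeless_graph_def complete_graph_def c)
qed

text \<open>The vertex class \<open>V\<^sub>i\<close> of \<^term>\<open>X_graph h r\<close>, for \<open>i \<le> r\<close>.\<close>

definition X_part :: "nat \<Rightarrow> nat \<Rightarrow> (nat + nat \<times> nat \<times> nat) set" where
  "X_part h i =
     (if i = 0 then Inl ` verts (edgeless_graph (h - 1))
      else Inr ` ({i} \<times> verts (copies (h div 2) (complete_graph 2))))"

lemma verts_X_graph: "verts (X_graph h r) = (\<Union>i\<le>r. X_part h i)"
proof -
  have "(\<Union>i\<le>r. X_part h i) = X_part h 0 \<union> (\<Union>i\<in>{1..r}. X_part h i)"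
    by (auto simp: Suc_le_eq) (metis Suc_le_eq atLeastAtMost_iff gr0I)
  then show ?thesis
    by (auto simp: X_part_def X_graph_def join_def join_family_def copies_def disjoint_union_def
        edgeless_graph_def complete_graph_def)
qed

lemma disjoint_X_part: "i \<noteq> j \<Longrightarrow> X_part h i \<inter> X_part h j = {}"
  by (auto simp: X_part_def)

text \<open>\<open>M\<close> consists of \<open>k\<close> disjoint edges on \<open>B\<close>; for \<open>card B = 2 * k\<close> they
  cover \<open>B\<close>.\<close>

definition pairing :: "nat \<Rightarrow> 'a set \<Rightarrow> 'a set set \<Rightarrow> bool" where
  "pairing k B M \<longleftrightarrow>
     (\<forall>e\<in>M. e \<subseteq> B \<and> card e = 2) \<and> disjoint M \<and> card M = k"

text \<open>The result of the construction, started from a graph \<open>X\<close> with vertex classes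
  \<open>V 0, \<dots>, V r\<close>, where \<open>B i\<close> are the new vertices and \<open>M i\<close> is the pairing
  chosen on \<open>B i\<close>. No pairing is used on \<open>B 0\<close>.\<close>

definition direction_construction ::
    "nat \<Rightarrow> 'a graph \<Rightarrow> (nat \<Rightarrow> 'a set) \<Rightarrow> (nat \<Rightarrow> 'a set) \<Rightarrow> (nat \<Rightarrow> 'a set set) \<Rightarrow> 'a graph" where
  "direction_construction r X V B M =
     \<lparr>verts = verts X \<union> (\<Union>i\<in>{0..r}. B i),
      edges = edges X \<union> (\<Union>i\<in>{1..r}. M i) \<union>
        {{u, v} | u v i j. i < j \<and> j \<le> r \<and> u \<in> V i \<union> B i \<and> v \<in> V j \<union> B j}\<rparr>"

text \<open>\<open>Y\<close> arises by the \<open>h\<close>-direction construction from some copy \<open>X\<close> of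
  \<^term>\<open>X_graph h r\<close> in the vertex type of \<open>Y\<close>. The isomorphism \<open>f\<close> carries over the
  vertex classes, which the bare graph need not determine: for \<open>h = 2\<close> it is complete.\<close>

definition h_direction :: "nat \<Rightarrow> nat \<Rightarrow> 'a graph \<Rightarrow> bool" where
  "h_direction h r Y \<longleftrightarrow>
     (\<exists>X f B M.
        graph_iso f (X_graph h r) X \<and>
        (\<forall>i\<le>r. card (B i) = h \<and> B i \<inter> verts X = {}) \<and>
        disjoint_family_on B {0..r} \<and>
        (\<forall>i\<in>{1..r}. pairing (h div 2) (B i) (M i)) \<and>
        Y = direction_construction r X (\<lambda>i. f ` X_part h i) B M)"

end

theory Submission
  imports Defs
begin

text \<open>Both \<^term>\<open>Y\<close> and \<^term>\<open>X_graph (2 * h) r\<close> are multipartite joins, so an isomorphism may be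
  glued from isomorphisms of corresponding parts. In part \<open>0\<close> only the size \<open>(h - 1) + h = 2 * h - 1\<close>
  matters. Each other part carries a perfect matching with \<open>h div 2 + h div 2 = h\<close> edges, and finite
  sets carrying perfect matchings of equal size are isomorphic.\<close>

section \<open>Multipartite joins and the gluing of isomorphisms\<close>

definition multipartite_join :: "nat \<Rightarrow> (nat \<Rightarrow> 'a set) \<Rightarrow> (nat \<Rightarrow> 'a set set) \<Rightarrow> 'a graph" where
  "multipartite_join r W E =
     \<lparr>verts = (\<Union>i\<le>r. W i),
      edges = (\<Union>i\<le>r. E i) \<union> {{u, v} | u v i j. i < j \<and> j \<le> r \<and> u \<in> W i \<and> v \<in> W j}\<rparr>"

text \<open>Each edge is written as an image of \<open>{..<2}\<close>, the only edge of
  \<open>complete_graph 2\<close>. This is also the shape in which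
  \<open>pairing_standard_form\<close> presents an arbitrary pairing, so the two can be matched
  directly.\<close>

definition X_part_edges :: "nat \<Rightarrow> nat \<Rightarrow> (nat + nat \<times> nat \<times> nat) set set" where
  "X_part_edges h i =
     (if i = 0 then {} else (\<lambda>k. (\<lambda>b. Inr (i, k, b)) ` {..<2}) ` {..<h div 2})"

text \<open>\<open>inv_into (verts G) f\<close> undoes \<open>f\<close> only on subsets of
  \<open>verts G\<close>, hence the assumption on edges. Gluing will produce a map out of
  \<open>X_graph (2 * h) r\<close>, while the theorem asks for one into it.\<close>

lemma graph_iso_sym:
  assumes "graph_iso f G H" and "\<And>e. e \<in> edges G \<Longrightarrow> e \<subseteq> verts G"
  shows "graph_iso (inv_into (verts G) f) H G"
proof -
  have f: "bij_betw f (verts G) (verts H)" and E: "edges H = (\<lambda>e. f ` e) ` edges G"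
    using assms(1) by (auto simp: graph_iso_def)
  have "(\<lambda>e. inv_into (verts G) f ` e) ` edges H = (\<lambda>e. e) ` edges G"
    unfolding E image_image
    by (intro image_cong refl) (simp add: assms(2) bij_betw_imp_inj_on[OF f] inv_into_image_cancel
        flip: image_comp image_image[of "inv_into (verts G) f" f])
  then show ?thesis
    using f by (simp add: graph_iso_def bij_betw_inv_into)
qed

text \<open>The image of \<open>{u, v}\<close> is \<open>{f u, f v}\<close>, so images pass through
  the edges between classes as well as through unions. This serves both to compare edges when gluing
  and to recognise a copy of \<open>X_graph h r\<close> as a multipartite join.\<close>

lemma edges_multipartite_join_image:
  "edges (multipartite_join r (\<lambda>i. f ` W i) (\<lambda>i. (\<lambda>e. f ` e) ` E i)) =
    (\<lambda>e. f ` e) ` edges (multipartite_join r W E)"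
proof -
  have "{{u, v} | u v i j. i < j \<and> j \<le> r \<and> u \<in> f ` W i \<and> v \<in> f ` W j} =
    (\<lambda>e. f ` e) ` {{u, v} | u v i j. i < j \<and> j \<le> r \<and> u \<in> W i \<and> v \<in> W j}" (is "?L = _ ` ?R")
  proof (intro equalityI subsetI)
    fix e assume "e \<in> ?L"
    then obtain u v i j where "i < j" "j \<le> r" "u \<in> W i" "v \<in> W j" and e: "e = f ` {u, v}"
      by auto
    then have "{u, v} \<in> ?R" by blast
    then show "e \<in> (\<lambda>e. f ` e) ` ?R" unfolding e by (rule imageI)
  next
    fix e assume "e \<in> (\<lambda>e. f ` e) ` ?R"
    then obtain u v i j where "i < j" "j \<le> r" "u \<in> W i" "v \<in> W j" and "e = {f u, f v}"
      by auto
    then show "e \<in> ?L" by blast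
  qed
  then show ?thesis
    by (simp add: multipartite_join_def image_Un image_UN)
qed

text \<open>Disjointness of the \<open>W i\<close> lets the \<open>g i\<close> merge into one
  function, and disjointness of the \<open>W' i\<close> keeps it injective. All edges between
  distinct classes are present on both sides, so only the edges of \<open>E i\<close> have to be
  carried over, and each of them lies in the single class \<open>W i\<close>.\<close>

lemma multipartite_join_glue:
  assumes W: "disjoint_family_on W {..r}" and W': "disjoint_family_on W' {..r}"
    and g: "\<And>i. i \<le> r \<Longrightarrow> bij_betw (g i) (W i) (W' i)"
    and E: "\<And>i e. i \<le> r \<Longrightarrow> e \<in> E i \<Longrightarrow> e \<subseteq> W i"
    and E': "\<And>i. i \<le> r \<Longrightarrow> E' i = (\<lambda>e. g i ` e) ` E i"
  shows "\<exists>f. graph_iso f (multipartite_join r W E) (multipartite_join r W' E')"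
proof -
  define f where "f x = g (THE i. i \<le> r \<and> x \<in> W i) x" for x
  have f: "f x = g i x" if "i \<le> r" "x \<in> W i" for i x
  proof -
    have "(THE i. i \<le> r \<and> x \<in> W i) = i"
      using that W by (intro the_equality) (auto simp: disjoint_family_on_def)
    then show ?thesis by (simp add: f_def)
  qed
  have bij: "bij_betw f (W i) (W' i)" if "i \<le> r" for i
    using g[OF that] f[OF that] by (simp cong: bij_betw_cong)
  have "bij_betw f (\<Union>i\<le>r. W i) (\<Union>i\<le>r. W' i)"
    using W' bij by (intro bij_betw_UNION_disjoint) auto
  moreover have "E' i = (\<lambda>e. f ` e) ` E i" if "i \<le> r" for i
    unfolding E'[OF that] using f[OF that] E[OF that]
    by (intro image_cong refl) (metis subsetD)
  moreover have "W' i = f ` W i" if "i \<le> r" for i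
    using bij[OF that] by (simp add: bij_betw_def)
  \<comment> \<open>The target is written as the image of the source under \<open>f\<close>, ready
    for \<open>edges_multipartite_join_image\<close>.\<close>
  ultimately have "edges (multipartite_join r W' E') =
      edges (multipartite_join r (\<lambda>i. f ` W i) (\<lambda>i. (\<lambda>e. f ` e) ` E i))"
    by (auto simp: multipartite_join_def) (metis imageI order.trans less_imp_le)+
  then have "graph_iso f (multipartite_join r W E) (multipartite_join r W' E')"
    using \<open>bij_betw f (\<Union>i\<le>r. W i) (\<Union>i\<le>r. W' i)\<close>
    by (simp add: graph_iso_def edges_multipartite_join_image) (simp add: multipartite_join_def)
  then show ?thesis
    by (rule exI[of _ f])
qed

section \<open>Pairings: images, unions and a standard form\<close>

lemma pairing_image:
  assumes "pairing k A M" and f: "inj_on f A"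
  shows "pairing k (f ` A) ((\<lambda>e. f ` e) ` M)"
proof -
  have M: "\<And>e. e \<in> M \<Longrightarrow> e \<subseteq> A \<and> card e = 2" "disjoint M" "card M = k"
    using assms(1) by (auto simp: pairing_def)
  have "inj_on (\<lambda>e. f ` e) M"
    using M(1) f by (auto intro!: inj_onI simp: inj_on_image_eq_iff)
  moreover have "disjoint ((\<lambda>e. f ` e) ` M)"
  proof (rule disjointI)
    fix a b assume "a \<in> (\<lambda>e. f ` e) ` M" "b \<in> (\<lambda>e. f ` e) ` M" "a \<noteq> b"
    then obtain c d where "c \<in> M" "d \<in> M" "c \<noteq> d" "a = f ` c" "b = f ` d" by auto
    then show "a \<inter> b = {}"
      using M(1,2) inj_on_image_Int[OF f, of c d] by (auto simp: disjoint_def)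
  qed
  moreover have "card (f ` e) = 2" if "e \<in> M" for e
    using M(1)[OF that] inj_on_subset[OF f] by (simp add: card_image)
  ultimately show ?thesis
    using M(1,3) by (auto simp: pairing_def card_image)
qed

lemma pairing_Un:
  assumes "pairing k A M" "pairing l B N" "A \<inter> B = {}" "finite A" "finite B"
  shows "pairing (k + l) (A \<union> B) (M \<union> N)"
proof -
  have M: "\<And>e. e \<in> M \<Longrightarrow> e \<subseteq> A \<and> card e = 2" "disjoint M" "card M = k"
    and N: "\<And>e. e \<in> N \<Longrightarrow> e \<subseteq> B \<and> card e = 2" "disjoint N" "card N = l"
    using assms(1,2) by (auto simp: pairing_def)
  have "finite M"
    using M(1) assms(4) by (auto intro: finite_subset[of _ "Pow A"])
  moreover have "finite N"
    using N(1) assms(5) by (auto intro: finite_subset[of _ "Pow B"])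
  \<comment> \<open>A common edge would lie in \<open>A \<inter> B\<close>, hence be empty, yet it
    has two elements.\<close>
  moreover have "M \<inter> N = {}"
    using M(1) N(1) assms(3) by (metis card.empty disjoint_iff le_inf_iff subset_empty zero_neq_numeral)
  ultimately have "card (M \<union> N) = k + l"
    using M(3) N(3) by (simp add: card_Un_disjoint)
  moreover have "disjoint (M \<union> N)"
    using M N assms(3) by (intro disjoint_union) blast+
  ultimately show ?thesis
    using M(1) N(1) by (auto simp: pairing_def)
qed

text \<open>Enumerating the edges by \<open>{..<k}\<close> and each edge by \<open>{..<2}\<close>
  gives \<open>g\<close>. The assumption on \<open>card A\<close> means that the pairs exhaust
  \<open>A\<close>, which makes \<open>g\<close> onto.\<close>

lemma pairing_standard_form:
  assumes "pairing k A M" "finite A" "card A = 2 * k"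
  obtains g where "bij_betw g ({..<k} \<times> {..<2::nat}) A"
    and "M = (\<lambda>j. (\<lambda>b. g (j, b)) ` {..<2}) ` {..<k}"
proof -
  have M: "\<And>e. e \<in> M \<Longrightarrow> e \<subseteq> A \<and> card e = 2" "disjoint M" "card M = k"
    using assms(1) by (auto simp: pairing_def)
  have "finite M"
    using M(1) assms(2) by (auto intro: finite_subset[of _ "Pow A"])
  then obtain m where m: "bij_betw m {..<k} M"
    using ex_bij_betw_nat_finite[of M] M(3) by (auto simp: atLeast0LessThan)
  have mM: "m j \<in> M" if "j < k" for j
    using bij_betwE[OF m] that by auto
  have "\<exists>c. bij_betw c {..<2::nat} (m j)" if "j < k" for j
    using M(1)[OF mM[OF that]] assms(2) ex_bij_betw_nat_finite[of "m j"]
    by (auto simp: atLeast0LessThan finite_subset)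
  then obtain c where c: "\<And>j. j < k \<Longrightarrow> bij_betw (c j) {..<2::nat} (m j)"
    by metis
  define g where "g = (\<lambda>(j, b). c j b)"
  have cm: "c j b \<in> m j" if "j < k" "b < 2" for j b
    using bij_betwE[OF c[OF that(1)]] that by auto
  \<comment> \<open>Equal values lie in two edges that meet; disjointness of \<open>M\<close> makes
    these edges equal, and then \<open>m\<close> and \<open>c j\<close> are injective.\<close>
  have inj: "inj_on g ({..<k} \<times> {..<2})"
  proof (rule inj_onI, clarsimp simp: g_def)
    fix i a j b assume *: "i < k" "a < 2" "j < k" "b < 2" "c i a = c j b"
    then have "m i \<inter> m j \<noteq> {}" using cm by (metis disjoint_iff)
    then have "m i = m j" using M(2) mM * by (auto simp: disjoint_def)
    then have "i = j" using m * by (auto simp: bij_betw_def inj_on_def)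
    then show "i = j \<and> a = b" using c[of j] * by (auto simp: bij_betw_def inj_on_def)
  qed
  have "g ` ({..<k} \<times> {..<2}) \<subseteq> A"
    using cm mM M(1) by (auto simp: g_def) blast
  \<comment> \<open>Surjectivity comes from counting: the image is a subset of the finite set
    \<open>A\<close> with as many elements, namely \<open>2 * k\<close>.\<close>
  moreover have "card (g ` ({..<k} \<times> {..<2})) = card A"
    using inj assms(3) by (simp add: card_image)
  ultimately have "bij_betw g ({..<k} \<times> {..<2}) A"
    using inj assms(2) by (simp add: bij_betw_def card_subset_eq)
  moreover have "(\<lambda>j. (\<lambda>b. g (j, b)) ` {..<2}) ` {..<k} = m ` {..<k}"
    using c by (intro image_cong refl) (simp add: g_def bij_betw_def)
  ultimately show thesis
    using that m by (simp add: bij_betw_def)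
qed

section \<open>The graph \<open>X_graph h r\<close> as a multipartite join\<close>

lemma X_part_0: "X_part h 0 = Inl ` {..<h - 1}"
  by (simp add: X_part_def edgeless_graph_def)

lemma X_part_pos:
  "i > 0 \<Longrightarrow> X_part h i = (\<lambda>(k, b). Inr (i, k, b)) ` ({..<h div 2} \<times> {..<2})"
  by (force simp: X_part_def copies_def disjoint_union_def complete_graph_def)

lemma card_X_part_0: "card (X_part h 0) = h - 1"
  by (simp add: X_part_0 card_image)

lemma card_X_part_pos: "i > 0 \<Longrightarrow> card (X_part h i) = 2 * (h div 2)"
  by (subst X_part_pos) (auto simp: card_image inj_on_def)

lemma finite_X_part: "finite (X_part h i)"
  by (cases "i = 0") (simp_all add: X_part_0 X_part_pos)

lemma pairing_X_part:
  assumes "i > 0"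
  shows "pairing (h div 2) (X_part h i) (X_part_edges h i)"
proof -
  have "inj_on (\<lambda>k. (\<lambda>b. Inr (i, k, b)) ` {..<2::nat} :: (nat + _) set) {..<h div 2}"
  proof (rule inj_onI)
    fix k l assume "(\<lambda>b. Inr (i, k, b)) ` {..<2::nat} =
      ((\<lambda>b. Inr (i, l, b)) ` {..<2} :: (nat + _) set)"
    \<comment> \<open>One element of the pair suffices to read off its index
      \<open>k\<close>.\<close>
    then have "Inr (i, k, 0) \<in> ((\<lambda>b. Inr (i, l, b)) ` {..<2::nat} :: (nat + _) set)"
      by (metis imageI lessThan_iff zero_less_numeral)
    then show "k = l" by auto
  qed
  then show ?thesis
    using assms
    by (auto simp: pairing_def X_part_edges_def X_part_pos card_image inj_on_def disjoint_def)
qed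

text \<open>This flattens the nested joins. Edges between classes have two origins: the inner
  \<open>join_family\<close> for two positive indices, and the outer \<open>join\<close> when one
  index is 0.\<close>

lemma X_graph_eq: "X_graph h r = multipartite_join r (X_part h) (X_part_edges h)"
proof -
  have K2: "{e. e \<subseteq> {..<2::nat} \<and> card e = 2} = {{..<2}}"
    using card_subset_eq[of "{..<2::nat}"] by auto
  have "X_part_edges h i =
      (\<lambda>e. Inr ` Pair i ` e) ` edges (copies (h div 2) (complete_graph 2))" if "i > 0" for i
    using that
    by (auto simp: X_part_edges_def copies_def disjoint_union_def complete_graph_def K2 image_image
        image_UN)
  moreover have "(\<Union>i\<le>r. X_part_edges h i) = (\<Union>i\<in>{1..r}. X_part_edges h i)"
  proof -
    have "{..r} = insert 0 {1..r}" by auto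
    then have "(\<Union>i\<le>r. X_part_edges h i) = X_part_edges h 0 \<union> (\<Union>i\<in>{1..r}. X_part_edges h i)"
      by simp
    then show ?thesis by (simp add: X_part_edges_def)
  qed
  ultimately have inner: "(\<lambda>e. Inr ` e) ` edges (disjoint_union {1..r} (\<lambda>_. copies (h div 2) (complete_graph 2)))
      = (\<Union>i\<le>r. X_part_edges h i)"
    by (simp add: disjoint_union_def image_image image_UN)
  define P where "P = {..<h div 2} \<times> {..<2::nat}"
  have P: "verts (copies (h div 2) (complete_graph 2)) = P"
    by (simp add: P_def copies_def disjoint_union_def complete_graph_def)
  have part: "X_part h i = (\<lambda>p. Inr (i, p)) ` P" if "i > 0" for i
    using that by (auto simp: X_part_def P)
  have "(\<lambda>e. Inr ` e) ` {{(i, u), (j, v)} | i j u v.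
           i \<in> {1..r} \<and> j \<in> {1..r} \<and> i \<noteq> j \<and> u \<in> P \<and> v \<in> P}
      \<union> {{Inl u, Inr v} | u v. u \<in> {..<h - 1} \<and> v \<in> {1..r} \<times> P}
      = {{u, v} | u v i j. i < j \<and> j \<le> r \<and> u \<in> X_part h i \<and> v \<in> X_part h j}"
    (is "_ ` ?A \<union> ?B = ?C")
  proof (intro equalityI subsetI)
    fix e assume "e \<in> (\<lambda>e. Inr ` e) ` ?A \<union> ?B"
    then show "e \<in> ?C"
    proof
      assume "e \<in> (\<lambda>e. Inr ` e) ` ?A"
      then obtain i j u v where *: "i \<in> {1..r}" "j \<in> {1..r}" "i \<noteq> j" "u \<in> P" "v \<in> P"
        and e: "e = {Inr (i, u), Inr (j, v)}"
        by auto
      then have "Inr (i, u) \<in> X_part h i" "Inr (j, v) \<in> X_part h j"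
        by (auto simp: part)
      \<comment> \<open>\<open>join_family\<close> allows either order of the distinct indices,
        whereas the right-hand side wants the smaller one first; the swapped form covers
        \<open>j < i\<close>.\<close>
      moreover have "e = {Inr (j, v), Inr (i, u)}" using e by auto
      moreover have "i < j \<or> j < i" "i \<le> r" "j \<le> r" using * by auto
      ultimately show ?thesis using e by blast
    next
      assume "e \<in> ?B"
      then obtain u w where uw: "e = {Inl u, Inr w}" "u \<in> {..<h - 1}" "w \<in> {1..r} \<times> P"
        by blast
      obtain j v where "w = (j, v)" by (rule prod.exhaust)
      with uw have "u < h - 1" "0 < j" "j \<le> r" "v \<in> P" "e = {Inl u, Inr (j, v)}"
        by auto
      moreover from this have "Inl u \<in> X_part h 0" "Inr (j, v) \<in> X_part h j"
        by (auto simp: X_part_0 part)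
      ultimately show ?thesis by blast
    qed
  next
    fix e assume "e \<in> ?C"
    then obtain i j u v where ij: "i < j" "j \<le> r" "u \<in> X_part h i" "v \<in> X_part h j" "e = {u, v}"
      by blast
    \<comment> \<open>Since \<open>i < j\<close>, the index \<open>j\<close> is positive, so only
      \<open>i\<close> can belong to the edgeless class.\<close>
    from ij obtain q where q: "q \<in> P" "v = Inr (j, q)" by (auto simp: part)
    show "e \<in> (\<lambda>e. Inr ` e) ` ?A \<union> ?B"
    proof (cases "i = 0")
      case True
      with ij obtain x where "x \<in> {..<h - 1}" "u = Inl x" by (auto simp: X_part_0)
      moreover have "(j, q) \<in> {1..r} \<times> P" using ij q True by simp
      ultimately show ?thesis using ij(5) q(2) by blast
    next
      case False
      with ij obtain p where p: "p \<in> P" "u = Inr (i, p)" by (auto simp: part)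
      have "i \<in> {1..r}" "j \<in> {1..r}" "i \<noteq> j" using ij False by auto
      then have "{(i, p), (j, q)} \<in> ?A" using p q by blast
      moreover have "e = Inr ` {(i, p), (j, q)}" using ij p q by auto
      ultimately show ?thesis by blast
    qed
  qed
  then have "edges (X_graph h r) = edges (multipartite_join r (X_part h) (X_part_edges h))"
    unfolding multipartite_join_def inner[symmetric]
    by (simp add: X_graph_def join_def join_family_def P edgeless_graph_def image_Un Un_assoc)
      (simp add: disjoint_union_def P)
  moreover have "verts (X_graph h r) = verts (multipartite_join r (X_part h) (X_part_edges h))"
    by (simp add: multipartite_join_def verts_X_graph)
  ultimately show ?thesis by simp
qed

section \<open>The construction as an enlargement of the classes, and the final isomorphism\<close>

lemma direction_construction_multipartite_join:
  "direction_construction r (multipartite_join r V E) V B M =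
    multipartite_join r (\<lambda>i. V i \<union> B i) (\<lambda>i. E i \<union> (if i = 0 then {} else M i))"
proof -
  have "(\<Union>i\<le>r. if i = 0 then {} else M i) = (\<Union>i\<in>{1..r}. M i)"
    by (auto split: if_splits) (metis Suc_leI atLeastAtMost_iff)
  \<comment> \<open>The old edges between classes are absorbed by the edges between the enlarged
    classes.\<close>
  then show ?thesis
    by (auto simp: direction_construction_def multipartite_join_def UN_Un_distrib atLeast0AtMost)
qed

theorem theorem6p1:
  fixes h r :: nat and Y :: "'a graph"
  assumes "even h" and "h \<ge> 2" and "r \<ge> 1"
    and "h_direction h r Y"
  shows "Y \<cong>\<^sub>g X_graph (2 * h) r"
proof -
  from assms(4) obtain X f B M where iso: "graph_iso f (X_graph h r) X"
    and B: "\<And>i. i \<le> r \<Longrightarrow> card (B i) = h" "\<And>i. i \<le> r \<Longrightarrow> B i \<inter> verts X = {}"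
      "disjoint_family_on B {0..r}"
    and M: "\<And>i. i \<in> {1..r} \<Longrightarrow> pairing (h div 2) (B i) (M i)"
    and Y: "Y = direction_construction r X (\<lambda>i. f ` X_part h i) B M"
    unfolding h_direction_def by blast
  \<comment> \<open>\<open>V\<close> and \<open>E\<close> are the classes and inner edges
    transported to \<open>X\<close> by \<open>f\<close>; \<open>W\<close> and \<open>F\<close> are
    the corresponding data of \<open>Y\<close>.\<close>
  define V where "V i = f ` X_part h i" for i
  define E where "E i = (\<lambda>e. f ` e) ` X_part_edges h i" for i
  define W where "W i = V i \<union> B i" for i
  define F where "F i = E i \<union> (if i = 0 then {} else M i)" for i
  have f: "bij_betw f (\<Union>i\<le>r. X_part h i) (verts X)"
    using iso by (simp add: graph_iso_def verts_X_graph)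
  have "verts X = (\<Union>i\<le>r. V i)"
    using f by (simp add: bij_betw_def V_def image_UN)
  moreover have "edges X = edges (multipartite_join r V E)"
    using iso by (simp add: graph_iso_def X_graph_eq V_def[abs_def] E_def[abs_def]
        edges_multipartite_join_image)
  ultimately have "X = multipartite_join r V E"
    by (simp add: multipartite_join_def)
  then have Y_eq: "Y = multipartite_join r W F"
    unfolding Y W_def[abs_def] F_def[abs_def]
    by (simp add: V_def[symmetric] direction_construction_multipartite_join)
  have inj: "inj_on f (X_part h i)" if "i \<le> r" for i
    using f that by (auto simp: bij_betw_def intro: inj_on_subset)
  have VB: "V i \<inter> B j = {}" if "i \<le> r" "j \<le> r" for i j
    using B(2)[OF that(2)] that(1) \<open>verts X = _\<close> by blast
  have finV: "finite (V i)" for i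
    by (simp add: V_def finite_X_part)
  \<comment> \<open>An infinite set has \<open>card\<close> 0, so the positive value
    \<open>h\<close> forces finiteness.\<close>
  have finB: "finite (B i)" if "i \<le> r" for i
    using B(1)[OF that] assms(2) by (intro card_ge_0_finite) simp
  have "V i \<inter> V j = {}" if "i \<le> r" "j \<le> r" "i \<noteq> j" for i j
  proof -
    have "V i \<inter> V j = f ` (X_part h i \<inter> X_part h j)"
      unfolding V_def using f that(1,2)
      by (intro inj_on_image_Int[symmetric]) (auto simp: bij_betw_def)
    then show ?thesis by (simp add: disjoint_X_part that(3))
  qed
  moreover have "B i \<inter> B j = {}" if "i \<le> r" "j \<le> r" "i \<noteq> j" for i j
    using B(3) that by (simp add: disjoint_family_on_def)
  ultimately have disjW: "disjoint_family_on W {..r}"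
    using VB by (simp add: disjoint_family_on_def W_def Int_Un_distrib Int_Un_distrib2 Int_commute)
  have cardV: "card (V i) = card (X_part h i)" if "i \<le> r" for i
    unfolding V_def using inj[OF that] by (rule card_image)
  have cardW: "card (W i) = card (X_part h i) + h" if "i \<le> r" for i
    using cardV[OF that] B(1)[OF that] VB[OF that that] finV finB[OF that]
    by (simp add: W_def card_Un_disjoint)
  have "\<exists>g. bij_betw g (X_part (2 * h) i) (W i) \<and>
      F i = (\<lambda>e. g ` e) ` X_part_edges (2 * h) i" if i: "i \<le> r" for i
  proof (cases "i = 0")
    case True
    \<comment> \<open>Part 0 has no inner edges, so equality of sizes is enough;
      \<open>h \<ge> 2\<close> keeps the subtraction in \<open>h - 1\<close> from
      truncating.\<close>
    have "card (X_part (2 * h) 0) = card (W 0)"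
      using cardW[of 0] assms(2) by (simp add: card_X_part_0)
    moreover have "finite (W 0)"
      using finV finB[of 0] by (simp add: W_def)
    ultimately obtain g where "bij_betw g (X_part (2 * h) 0) (W 0)"
      using finite_same_card_bij[OF finite_X_part] by blast
    then show ?thesis
      using True by (auto simp: F_def E_def X_part_edges_def)
  next
    case False
    \<comment> \<open>The transported old pairing on \<open>V i\<close> and the new pairing on
      \<open>B i\<close> are put together; evenness of \<open>h\<close> then turns the number of
      pairs into \<open>h\<close>.\<close>
    have "pairing (h div 2 + h div 2) (W i) (F i)"
      using False i VB[OF i i] finV finB[OF i]
      by (simp add: W_def F_def)
        (intro pairing_Un M, auto simp: V_def E_def intro!: pairing_image pairing_X_part inj)
    then have "pairing h (W i) (F i)"
      using assms(1) by (simp flip: mult_2)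
    moreover have "card (W i) = 2 * h"
      using cardW[OF i] False assms(1) by (simp add: card_X_part_pos)
    moreover have "finite (W i)"
      using finV finB[OF i] by (simp add: W_def)
    ultimately obtain g where g: "bij_betw g ({..<h} \<times> {..<2::nat}) (W i)"
        "F i = (\<lambda>j. (\<lambda>b. g (j, b)) ` {..<2}) ` {..<h}"
      using pairing_standard_form by metis
    \<comment> \<open>The standard form is indexed by \<open>{..<h} \<times> {..<2}\<close>, which
      is \<open>X_part (2 * h) i\<close> without its tags \<open>Inr\<close> and \<open>i\<close>;
      \<open>g'\<close> strips these first.\<close>
    define g' where "g' x = g (snd (projr x))" for x :: "nat + nat \<times> nat \<times> nat"
    have "bij_betw g' (X_part (2 * h) i) (W i)"
      using g(1) False unfolding bij_betw_def
      by (force simp: X_part_pos g'_def inj_on_def image_image case_prod_unfold)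
    moreover have "F i = (\<lambda>e. g' ` e) ` X_part_edges (2 * h) i"
      using False by (simp add: g(2) X_part_edges_def g'_def image_image)
    ultimately show ?thesis by blast
  qed
  then obtain g where g: "\<And>i. i \<le> r \<Longrightarrow> bij_betw (g i) (X_part (2 * h) i) (W i)"
      "\<And>i. i \<le> r \<Longrightarrow> F i = (\<lambda>e. g i ` e) ` X_part_edges (2 * h) i"
    by metis
  have "e \<subseteq> X_part (2 * h) i" if "e \<in> X_part_edges (2 * h) i" for i e
    using that pairing_X_part[of i "2 * h"]
    by (cases "i = 0") (auto simp: pairing_def X_part_edges_def)
  moreover have "disjoint_family_on (X_part (2 * h)) {..r}"
    by (simp add: disjoint_family_on_def disjoint_X_part)
  ultimately obtain k where "graph_iso k (X_graph (2 * h) r) Y"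
    using multipartite_join_glue[where W = "X_part (2 * h)" and W' = W and g = g] disjW g
    unfolding X_graph_eq Y_eq by metis
  \<comment> \<open>The glued map runs from the standard graph to \<open>Y\<close>, so it is
    inverted; simplicity of \<open>X_graph (2 * h) r\<close> keeps its edges inside its vertex
    set.\<close>
  then have "graph_iso (inv_into (verts (X_graph (2 * h) r)) k) Y (X_graph (2 * h) r)"
    using simple_graph_X_graph by (intro graph_iso_sym) (auto simp: simple_graph_def)
  then show ?thesis
    by (auto simp: isomorphic_def)
qed

end
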